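(* Let $N\ge2$, let $a,b,\theta>0$ and let $s\in\mathbb{C}$ with $\Re(a-s/2)>0$. Let $\mathbf{U}$ be a random vector of $\mathbb{R}^N$. (1) If $\mathbf{U}$ has the Selberg density $$\frac{N!}{S_N(a,b,1)}\Big(\prod_{1\le i<j\le N}(u_j-u_i)\Big)^2\prod_{n=1}^N u_n^{a-1}(1-u_n)^{b-1}$$ on $\{0<u_1<u_2<\cdots<u_N<1\}$, then $$ \mathbb{E}\left[\frac{V_N^{(s/2)}(\mathbf{U})}{V_N^{(0)}(\mathbf{U})}\right]=\frac{2N^{s/2}}{s\,\Gamma_{N-1}\left(\frac s2\right)}\,\frac{\Gamma(a+b-1+N)}{\Gamma\left(a-\frac s2+b-1+N\right)}\,\frac{\Gamma\left(a-\frac s2\right)}{\Gamma(a)}. $$ (2) If $\mathbf{U}$ has the Laguerre ensemble density $$\frac{N!}{W_N(a,\theta)}\Big(\prod_{1\le i<j\le N}(u_j-u_i)\Big)^2\prod_{n=1}^N u_n^{a-1}e^{-u_n/\theta}$$ on $\{0<u_1<u_2<\cdots<u_N\}$, then $$ \mathbb{E}\left[\frac{V_N^{(s/2)}(\mathbf{U})}{V_N^{(0)}(\mathbf{U})}\right]=\frac{2}{s\,\Gamma_{N-1}\left(\frac s2\right)}\left(\frac N\theta\right)^{s/2}\frac{\Gamma\left(a-\frac s2\right)}{\Gamma(a)}. $$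
   Context: For $\mathbf{u}=(u_1,\dots,u_N)$ with positive entries, $V_N^{(s/2)}(\mathbf{u})$ is the determinant of the $N\times N$ matrix whose $i$-th row is $(u_i^{-s/2},u_i,u_i^2,\dots,u_i^{N-1})$; in particular $V_N^{(0)}(\mathbf{u})=\prod_{1\le i<j\le N}(u_j-u_i)$. Complex powers of positive reals use the real logarithm. The normalizing constants are $$S_N(a,b,1)=\prod_{n=0}^{N-1}\frac{\Gamma(a+n)\Gamma(b+n)\Gamma(2+n)}{\Gamma(a+b-1+N+n)},\qquad W_N(a,\theta)=\theta^{(a+N-1)N}\prod_{n=0}^{N-1}\Gamma(a+n)\Gamma(2+n),$$ which make the two densities integrate to $1$. For $N>1$, $$\Gamma_{N-1}\left(\tfrac s2\right)=\frac2s\prod_{n=1}^{N-1}\frac{(1+\frac1n)^{s/2}}{1+\frac{s}{2n}},$$ and the factor $\frac{2}{s\Gamma_{N-1}(s/2)}$ is understood for all $s\in\mathbb{C}$ as the entire function $\prod_{n=1}^{N-1}\left(1+\frac{s}{2n}\right)\left(1+\frac1n\right)^{-s/2}$. *)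

theory Defs
  imports "HOL-Probability.Probability" "Jordan_Normal_Form.Determinant"
begin

text \<open>
  A vector \<open>(u\<^sub>1, \<dots>, u\<^sub>N)\<close> is a function \<open>u :: nat \<Rightarrow> real\<close> on the index set \<open>{..<N}\<close>, with
  \<open>u\<^sub>i\<close> at index \<open>i - 1\<close>. The function \<open>vandermonde_pow N z\<close> is $V_N^{(z)}$; the base of
  \<open>powr\<close> is a positive real, where the principal logarithm is the real one.
\<close>

definition vandermonde_pow :: "nat \<Rightarrow> complex \<Rightarrow> (nat \<Rightarrow> real) \<Rightarrow> complex" where
  "vandermonde_pow N z u =
     Determinant.det (Matrix.mat N N (\<lambda>(i, j).
       if j = 0 then complex_of_real (u i) powr (- z) else complex_of_real (u i) ^ j))"

definition vandermonde_prod :: "nat \<Rightarrow> (nat \<Rightarrow> real) \<Rightarrow> real" where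
  "vandermonde_prod N u = (\<Prod>j<N. \<Prod>i<j. u j - u i)"

text \<open>
  The constants below are the values of the Selberg integral (with parameter $\gamma = 1$) and of
  its Laguerre limit over all of $(0,1)^N$, respectively $(0,\infty)^N$; restricting to ordered
  vectors accounts for the factor $N!$ in the densities.
\<close>

definition selberg_const :: "nat \<Rightarrow> real \<Rightarrow> real \<Rightarrow> real" where
  "selberg_const N a b =
     (\<Prod>n<N. Gamma (a + real n) * Gamma (b + real n) * Gamma (2 + real n)
              / Gamma (a + b - 1 + real N + real n))"

definition laguerre_const :: "nat \<Rightarrow> real \<Rightarrow> real \<Rightarrow> real" where
  "laguerre_const N a \<theta> =
     \<theta> powr ((a + real N - 1) * real N) * (\<Prod>n<N. Gamma (a + real n) * Gamma (2 + real n))"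

definition selberg_density :: "nat \<Rightarrow> real \<Rightarrow> real \<Rightarrow> (nat \<Rightarrow> real) \<Rightarrow> real" where
  "selberg_density N a b u =
     (if strict_mono_on {..<N} u \<and> (\<forall>n<N. 0 < u n \<and> u n < 1)
      then fact N / selberg_const N a b * (vandermonde_prod N u)\<^sup>2
             * (\<Prod>n<N. u n powr (a - 1) * (1 - u n) powr (b - 1))
      else 0)"

definition laguerre_density :: "nat \<Rightarrow> real \<Rightarrow> real \<Rightarrow> (nat \<Rightarrow> real) \<Rightarrow> real" where
  "laguerre_density N a \<theta> u =
     (if strict_mono_on {..<N} u \<and> (\<forall>n<N. 0 < u n)
      then fact N / laguerre_const N a \<theta> * (vandermonde_prod N u)\<^sup>2
             * (\<Prod>n<N. u n powr (a - 1) * exp (- u n / \<theta>))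
      else 0)"

text \<open>
  \<open>Gamma_trunc m z\<close> is $\Gamma_m(z)$ from Euler's product, and \<open>recip_Gamma_trunc m z\<close> is the
  entire continuation in \<open>z\<close> of $1/(z\,\Gamma_m(z))$; for $z = s/2$ this is
  $2/(s\,\Gamma_m(s/2))$.
\<close>

definition Gamma_trunc :: "nat \<Rightarrow> complex \<Rightarrow> complex" where
  "Gamma_trunc m z =
     1 / z * (\<Prod>n=1..m. complex_of_real (1 + 1 / real n) powr z / (1 + z / of_nat n))"

definition recip_Gamma_trunc :: "nat \<Rightarrow> complex \<Rightarrow> complex" where
  "recip_Gamma_trunc m z =
     (\<Prod>n=1..m. (1 + z / of_nat n) * complex_of_real (1 + 1 / real n) powr (- z))"

lemma recip_Gamma_trunc_eq:
  assumes "z \<noteq> 0"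
  shows "recip_Gamma_trunc m z = 1 / (z * Gamma_trunc m z)"
proof -
  have "recip_Gamma_trunc m z =
    inverse (\<Prod>n=1..m. complex_of_real (1 + 1 / real n) powr z / (1 + z / of_nat n))"
    unfolding recip_Gamma_trunc_def prod_inversef[symmetric] o_def
    by (intro prod.cong refl) (simp add: powr_minus divide_simps)
  then show ?thesis
    using assms by (simp add: Gamma_trunc_def inverse_eq_divide)
qed

end

theory Submission
  imports Defs
begin

text \<open>
  Andreief's identity turns the integral of \<open>V\<^sub>N\<^sup>(\<^sup>z\<^sup>) V\<^sub>N\<^sup>(\<^sup>0\<^sup>)\<close> against a product weight \<open>w(u\<^sub>1) \<cdots> w(u\<^sub>N)\<close>
  over ordered vectors into the determinant \<open>D(z)\<close> of the matrix of moments of \<open>w\<close> whose row \<open>0\<close>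
  has the entries \<open>m(j - z)\<close>, \<open>0 \<le> j < N\<close>, and whose row \<open>i > 0\<close> has the entries \<open>m(j + i)\<close>. Hence the
  expectation is \<open>D(z) / D(0)\<close>.

  For the Beta and Gamma weights, \<open>m(j - z) = G(z) q\<^sub>j(z)\<close> with polynomials \<open>q\<^sub>j\<close> of degree at most
  \<open>N - 1\<close>, so \<open>D(z) / G(z)\<close> is a polynomial of degree at most \<open>N - 1\<close>. It vanishes at
  \<open>z = -1, \<dots>, -(N - 1)\<close>, where two rows coincide, and is therefore proportional to
  \<open>\<Prod>\<^sub>k (1 + z / k)\<close>.
\<close>

subsection \<open>Determinants\<close>

lemma det_mat_leibniz:
  fixes f :: "nat \<Rightarrow> nat \<Rightarrow> 'a :: comm_ring_1"
  shows "Determinant.det (Matrix.mat n n (\<lambda>(i, j). f i j)) =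
    (\<Sum>p | p permutes {..<n}. of_int (sign p) * (\<Prod>i<n. f i (p i)))"
proof -
  have "p i < n" if "p permutes {..<n}" "i < n" for p i
    using permutes_in_image[OF that(1), of i] that(2) by simp
  then show ?thesis
    by (subst det_def'[of _ n])
       (auto simp: sign_def atLeast0LessThan intro!: sum.cong prod.cong)
qed

text \<open>With the permutation on the row index, a signed sum of
  \<open>\<Prod>i<n. f i (u (p i))\<close> over all \<open>p\<close> is recognised as the
  determinant of the matrix with entries \<open>f j (u i)\<close>; Andreief's identity uses it this
  way.\<close>

lemma det_mat_leibniz_columns:
  fixes f :: "nat \<Rightarrow> nat \<Rightarrow> 'a :: comm_ring_1"
  shows "Determinant.det (Matrix.mat n n (\<lambda>(i, j). f i j)) =
    (\<Sum>p | p permutes {..<n}. of_int (sign p) * (\<Prod>i<n. f (p i) i))"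
proof -
  have "Determinant.det (Matrix.mat n n (\<lambda>(i, j). f i j)) =
      Determinant.det (transpose_mat (Matrix.mat n n (\<lambda>(i, j). f i j)))"
    by (rule det_transpose[of _ n, symmetric]) simp
  also have "transpose_mat (Matrix.mat n n (\<lambda>(i, j). f i j)) = Matrix.mat n n (\<lambda>(i, j). f j i)"
    by (rule eq_matI) auto
  also have "Determinant.det \<dots> = (\<Sum>p | p permutes {..<n}. of_int (sign p) * (\<Prod>i<n. f (p i) i))"
    by (rule det_mat_leibniz)
  finally show ?thesis .
qed

lemma det_scale_rows:
  fixes f :: "nat \<Rightarrow> nat \<Rightarrow> 'a :: comm_ring_1"
  shows "Determinant.det (Matrix.mat n n (\<lambda>(i, j). c i * f i j)) =
    (\<Prod>i<n. c i) * Determinant.det (Matrix.mat n n (\<lambda>(i, j). f i j))"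
  unfolding det_mat_leibniz by (simp add: prod.distrib sum_distrib_left mult_ac)

lemma det_permute_rows_lessThan:
  fixes f :: "nat \<Rightarrow> nat \<Rightarrow> 'a :: comm_ring_1"
  assumes "p permutes {..<n}"
  shows "Determinant.det (Matrix.mat n n (\<lambda>(i, j). f (p i) j)) =
    of_int (sign p) * Determinant.det (Matrix.mat n n (\<lambda>(i, j). f i j))"
proof -
  have "p i < n" if "i < n" for i
    using permutes_in_image[OF assms, of i] that by simp
  then have "Matrix.mat n n (\<lambda>(i, j). f (p i) j) =
      Matrix.mat n n (\<lambda>(i, j). Matrix.mat n n (\<lambda>(i, j). f i j) $$ (p i, j))"
    by (intro eq_matI) auto
  then show ?thesis
    using det_permute_rows[of "Matrix.mat n n (\<lambda>(i, j). f i j)" n p] assms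
    by (simp add: atLeast0LessThan sign_def)
qed

lemma det_mat_equal_rows:
  fixes f :: "nat \<Rightarrow> nat \<Rightarrow> 'a :: comm_ring_1"
  assumes "i < n" "j < n" "i \<noteq> j" "\<And>k. k < n \<Longrightarrow> f i k = f j k"
  shows "Determinant.det (Matrix.mat n n (\<lambda>(i, j). f i j)) = 0"
  by (rule det_identical_rows[of _ n i j]) (use assms in \<open>auto intro!: eq_vecI\<close>)

lemma det_mat_cong:
  assumes "\<And>i j. i < n \<Longrightarrow> j < n \<Longrightarrow> f i j = g i j"
  shows "Determinant.det (Matrix.mat n n (\<lambda>(i, j). f i j)) = Determinant.det (Matrix.mat n n (\<lambda>(i, j). g i j))"
  by (rule arg_cong[where f = Determinant.det]) (use assms in \<open>auto intro!: eq_matI\<close>)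

text \<open>Deleting row \<open>k\<close> removes every entry in which the two matrices may differ.
  In a Laplace expansion along row \<open>k\<close>, the coefficients are thus independent of that
  row, and the determinant becomes a polynomial when the row entries are polynomials.\<close>

lemma cofactor_mat_cong:
  fixes f g :: "nat \<Rightarrow> nat \<Rightarrow> 'a :: comm_ring_1"
  assumes "k < n" and "\<And>i j. i < n \<Longrightarrow> i \<noteq> k \<Longrightarrow> j < n \<Longrightarrow> f i j = g i j"
  shows "cofactor (Matrix.mat n n (\<lambda>(i, j). f i j)) k l = cofactor (Matrix.mat n n (\<lambda>(i, j). g i j)) k l"
proof -
  have "mat_delete (Matrix.mat n n (\<lambda>(i, j). f i j)) k l =
      mat_delete (Matrix.mat n n (\<lambda>(i, j). g i j)) k l"
    unfolding mat_delete_def by (rule eq_matI) (use assms in auto)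
  then show ?thesis
    by (simp add: cofactor_def)
qed

text \<open>Induction on the size: with the last node replaced by a variable \<open>t\<close>, the
  determinant is a polynomial in \<open>t\<close> of degree at most \<open>n\<close>. It vanishes at
  the first \<open>n\<close> nodes, where two rows coincide, and its coefficient at
  \<open>t^n\<close> is the smaller Vandermonde determinant \<open>d\<close>. Injectivity makes
  these nodes \<open>n\<close> distinct points.\<close>

lemma det_vandermonde:
  fixes x :: "nat \<Rightarrow> 'a :: field"
  assumes "inj_on x {..<n}"
  shows "Determinant.det (Matrix.mat n n (\<lambda>(i, j). x i ^ j)) = (\<Prod>j<n. \<Prod>i<j. x j - x i)"
  using assms
proof (induction n)
  case 0
  then show ?case by (simp add: det_mat_leibniz)
next
  case (Suc n)
  define A where "A t = Matrix.mat (Suc n) (Suc n) (\<lambda>(i, j). (if i < n then x i else t) ^ j)" for t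
  define p where "p = (\<Sum>j<Suc n. monom (cofactor (A 0) n j) j)"
  have det_A: "Determinant.det (A t) = poly p t" for t
  proof -
    have "cofactor (A t) n j = cofactor (A 0) n j" for j
      unfolding A_def by (rule cofactor_mat_cong) auto
    then show ?thesis
      by (subst laplace_expansion_row[of _ "Suc n" n])
         (auto simp: p_def poly_sum poly_monom A_def mult.commute intro!: sum.cong)
  qed
  have IH: "Determinant.det (Matrix.mat n n (\<lambda>(i, j). x i ^ j)) = (\<Prod>j<n. \<Prod>i<j. x j - x i)"
    by (rule Suc.IH, rule inj_on_subset[OF Suc.prems]) auto
  define d where "d = Determinant.det (Matrix.mat n n (\<lambda>(i, j). x i ^ j))"
  have "mat_delete (A 0) n n = Matrix.mat n n (\<lambda>(i, j). x i ^ j)"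
    by (rule eq_matI) (auto simp: A_def mat_delete_def)
  then have cof: "cofactor (A 0) n n = d"
    by (simp add: cofactor_def d_def)
  define q where "q = Polynomial.smult d (\<Prod>i<n. [:- x i, 1:])"
  have degree_monic: "degree (\<Prod>i<n. [:- x i, 1:]) = n"
    by (simp add: degree_prod_eq_sum_degree)
  moreover have "lead_coeff (\<Prod>i<n. [:- x i, 1:]) = 1"
    by (simp add: lead_coeff_prod)
  ultimately have monic: "poly.coeff (\<Prod>i<n. [:- x i, 1:]) n = 1"
    by simp
  \<comment> \<open>Both sides have degree at most \<open>n\<close> and the same coefficient
    \<open>d\<close> at \<open>t^n\<close>, so their difference has degree below \<open>n\<close>
    and agreement at the \<open>n\<close> nodes suffices.\<close>
  have "p = q"
  proof (rule poly_eqI_degree_lead_coeff[where n = n and A = "x ` {..<n}"])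
    show "poly.coeff p n = poly.coeff q n"
      using monic by (simp add: p_def q_def coeff_sum coeff_monom cof sum.delta)
    show "card (x ` {..<n}) \<ge> n"
      by (subst card_image, rule inj_on_subset[OF Suc.prems]) auto
    show "degree p \<le> n"
      unfolding p_def by (intro degree_sum_le) (auto intro: order.trans[OF degree_monom_le])
    show "degree q \<le> n"
      unfolding q_def using degree_monic degree_smult_le by metis
    fix z assume "z \<in> x ` {..<n}"
    then obtain k where k: "k < n" "z = x k" by auto
    have "Determinant.det (A z) = 0"
      unfolding A_def by (rule det_mat_equal_rows[of k _ n]) (use k in auto)
    moreover have "poly q z = 0"
      using k by (auto simp: q_def poly_prod)
    ultimately show "poly p z = poly q z"
      by (simp add: det_A)
  qed
  have "A (x n) = Matrix.mat (Suc n) (Suc n) (\<lambda>(i, j). x i ^ j)"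
    unfolding A_def by (rule eq_matI) (auto simp: less_Suc_eq)
  then have "Determinant.det (Matrix.mat (Suc n) (Suc n) (\<lambda>(i, j). x i ^ j)) = poly q (x n)"
    using det_A[of "x n"] \<open>p = q\<close> by simp
  also have "\<dots> = (\<Prod>j<Suc n. \<Prod>i<j. x j - x i)"
    by (simp add: q_def poly_prod d_def IH)
  finally show ?case .
qed

text \<open>Two polynomials of degree at most \<open>n\<close> are compared at the
  \<open>n + 1\<close> points \<open>0, -1, ..., -n\<close>. The factors are normalised to
  \<open>1\<close> at \<open>0\<close>, which makes \<open>poly Q 0\<close> the constant of
  proportionality.\<close>

lemma poly_eq_prod_of_negative_roots:
  fixes Q :: "complex poly"
  assumes "degree Q \<le> n" and "\<And>k. k \<in> {1..n} \<Longrightarrow> poly Q (- of_nat k) = 0"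
  shows "poly Q z = poly Q 0 * (\<Prod>k=1..n. 1 + z / of_nat k)"
proof -
  define R where "R = Polynomial.smult (poly Q 0) (\<Prod>k=1..n. [:1, 1 / of_nat k:])"
  have "Q = R"
  proof (rule poly_eqI_degree[where A = "(\<lambda>k. - of_nat k) ` {0..n}"])
    have "card ((\<lambda>k. - of_nat k :: complex) ` {0..n}) = Suc n"
      by (subst card_image) (auto simp: inj_on_def)
    moreover have "degree (\<Prod>k=1..n. [:1, 1 / of_nat k :: complex:]) \<le> (\<Sum>k=1..n. 1)"
      by (rule order.trans[OF degree_prod_sum_le sum_mono]) auto
    then have "degree R \<le> n"
      unfolding R_def using degree_smult_le order.trans by fastforce
    ultimately show "degree Q < card ((\<lambda>k. - of_nat k :: complex) ` {0..n})"
      "degree R < card ((\<lambda>k. - of_nat k :: complex) ` {0..n})"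
      using assms(1) by simp_all
    fix x assume "x \<in> (\<lambda>k. - of_nat k :: complex) ` {0..n}"
    then obtain k where k: "k \<le> n" "x = - of_nat k" by auto
    show "poly Q x = poly R x"
    proof (cases "k = 0")
      case True
      then show ?thesis using k by (simp add: R_def poly_prod)
    next
      case False
      then have "(\<Prod>i=1..n. 1 + x / of_nat i) = 0"
        using k by (intro prod_zero bexI[of _ k]) auto
      then have "poly R x = 0"
        by (simp add: R_def poly_prod)
      then show ?thesis
        using assms(2)[of k] False k by simp
    qed
  qed
  then have "poly Q z = poly R z" by simp
  then show ?thesis
    by (simp add: R_def poly_prod)
qed

text \<open>
  Up to the factor \<open>G z\<close>, the determinant is a polynomial in \<open>z\<close> of degree less than \<open>n\<close> which
  vanishes at \<open>z = - k\<close> for \<open>0 < k < n\<close>, because there the row \<open>0\<close> repeats the row \<open>k\<close>.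
\<close>

lemma det_interpolated_row:
  fixes q :: "nat \<Rightarrow> complex poly" and G :: "complex \<Rightarrow> complex"
  assumes "n > 0" and deg: "\<And>j. j < n \<Longrightarrow> degree (q j) \<le> n - 1"
    and c: "\<And>i j. i < n \<Longrightarrow> j < n \<Longrightarrow> c i j = G (- of_nat i) * poly (q j) (- of_nat i)"
    and G: "\<And>i. i < n \<Longrightarrow> G (- of_nat i) \<noteq> 0"
    and b: "\<And>j. j < n \<Longrightarrow> b j = G z * poly (q j) z"
  shows "G 0 * Determinant.det (Matrix.mat n n (\<lambda>(i, j). if i = 0 then b j else c i j)) =
    G z * (\<Prod>k=1..n-1. 1 + z / of_nat k) * Determinant.det (Matrix.mat n n (\<lambda>(i, j). c i j))"
proof -
  define Q where
    "Q = (\<Sum>j<n. Polynomial.smult (cofactor (Matrix.mat n n (\<lambda>(i, j). c i j)) 0 j) (q j))"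
  \<comment> \<open>The cofactors in \<open>Q\<close> do not see row \<open>0\<close>, so one
    polynomial serves every first row proportional to the values of the \<open>q j\<close> at a
    point. It is applied to row \<open>k\<close> of \<open>c\<close>, to row \<open>0\<close> of
    \<open>c\<close>, and to \<open>b\<close>.\<close>
  have expand: "Determinant.det (Matrix.mat n n (\<lambda>(i, j). if i = 0 then r j else c i j)) = a * poly Q x"
    if r: "\<And>j. j < n \<Longrightarrow> r j = a * poly (q j) x" for r a x
  proof -
    have "cofactor (Matrix.mat n n (\<lambda>(i, j). if i = 0 then r j else c i j)) 0 j =
        cofactor (Matrix.mat n n (\<lambda>(i, j). c i j)) 0 j" for j
      using \<open>n > 0\<close> by (rule cofactor_mat_cong) auto
    then show ?thesis
      using \<open>n > 0\<close>
      by (subst laplace_expansion_row[of _ n 0])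
         (auto simp: Q_def poly_sum r sum_distrib_left mult_ac intro!: sum.cong)
  qed
  \<comment> \<open>Row \<open>k\<close> of \<open>c\<close> has the form required by
    \<open>expand\<close> with scalar \<open>G (- k)\<close>; since this scalar is nonzero, the
    repeated row forces the root of \<open>Q\<close>.\<close>
  have "poly Q (- of_nat k) = 0" if "k \<in> {1..n-1}" for k
  proof -
    have "Determinant.det (Matrix.mat n n (\<lambda>(i, j). if i = 0 then c k j else c i j)) = 0"
      by (rule det_mat_equal_rows[of 0 _ k]) (use that in auto)
    then show ?thesis
      using expand[of "c k" "G (- of_nat k)" "- of_nat k"] c[of k] G[of k] that by force
  qed
  moreover have "degree Q \<le> n - 1"
    unfolding Q_def using deg by (intro degree_sum_le order.trans[OF degree_smult_le]) auto
  ultimately have Q: "poly Q z = poly Q 0 * (\<Prod>k=1..n-1. 1 + z / of_nat k)"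
    by (intro poly_eq_prod_of_negative_roots)
  have "Determinant.det (Matrix.mat n n (\<lambda>(i, j). c i j)) =
      Determinant.det (Matrix.mat n n (\<lambda>(i, j). if i = 0 then c 0 j else c i j))"
    by (rule det_mat_cong) auto
  also have "\<dots> = G 0 * poly Q 0"
    using c[of 0] \<open>n > 0\<close> by (intro expand) auto
  finally show ?thesis
    using expand[of b "G z" z] b by (simp add: Q)
qed

subsection \<open>Integration over ordered vectors\<close>

lemma strict_mono_on_lessThan_iff:
  fixes n :: nat
  shows
  "strict_mono_on {..<n} v \<longleftrightarrow> (\<forall>j\<in>{..<n}. \<forall>i\<in>{..<j}. v i < (v j :: 'a :: linorder))"
  by (auto simp: strict_mono_on_def)

lemma strict_mono_on_lessThan_cong:
  fixes n :: nat
  assumes "\<And>i. i < n \<Longrightarrow> u i = v i"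
  shows "strict_mono_on {..<n} u \<longleftrightarrow> strict_mono_on {..<n} v"
  using assms by (auto simp: strict_mono_on_def)

text \<open>A vector without ties lies in exactly one chamber. Existence: list the values in
  increasing order and pull the positions back through \<open>u\<close>. Uniqueness: a strictly
  increasing list is determined by its set of entries, and \<open>u\<close> is injective.\<close>

lemma ex1_sorting_permutation:
  fixes u :: "nat \<Rightarrow> 'a :: linorder"
  assumes inj: "inj_on u {..<n}"
  shows "\<exists>!p. p permutes {..<n} \<and> strict_mono_on {..<n} (u \<circ> p)"
proof (rule ex_ex1I)
  define xs where "xs = sorted_list_of_set (u ` {..<n})"
  have len: "length xs = n"
    using inj by (simp add: xs_def card_image)
  have set: "set xs = u ` {..<n}"
    by (simp add: xs_def)
  have bij_xs: "bij_betw ((!) xs) {..<n} (u ` {..<n})"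
    by (rule bij_betw_nth) (simp_all add: len set, simp add: xs_def)
  have bij_u: "bij_betw u {..<n} (u ` {..<n})"
    using inj by (rule inj_on_imp_bij_betw)
  define q where "q = inv_into {..<n} u \<circ> (!) xs"
  \<comment> \<open>\<open>permutes\<close> requires the identity outside
    \<open>{..<n}\<close>.\<close>
  define p where "p i = (if i < n then q i else i)" for i
  have "bij_betw q {..<n} {..<n}"
    unfolding q_def using bij_xs bij_betw_inv_into[OF bij_u] by (rule bij_betw_trans)
  then have "bij_betw p {..<n} {..<n}"
    by (subst bij_betw_cong[of _ p q]) (auto simp: p_def)
  then have "p permutes {..<n}"
    by (rule bij_imp_permutes) (simp add: p_def)
  moreover have "u (p i) = xs ! i" if "i < n" for i
  proof -
    have "xs ! i \<in> u ` {..<n}"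
      using that len set nth_mem[of i xs] by simp
    then show ?thesis
      using that by (simp add: p_def q_def f_inv_into_f)
  qed
  then have "strict_mono_on {..<n} (u \<circ> p)"
    using sorted_wrt_nth_less[OF strict_sorted_list_of_set[of "u ` {..<n}"]] len
    by (auto simp: strict_mono_on_def xs_def)
  ultimately show "\<exists>p. p permutes {..<n} \<and> strict_mono_on {..<n} (u \<circ> p)"
    by blast
next
  fix p q
  assume p: "p permutes {..<n} \<and> strict_mono_on {..<n} (u \<circ> p)"
    and q: "q permutes {..<n} \<and> strict_mono_on {..<n} (u \<circ> q)"
  have sorted: "sorted_wrt (<) (map (u \<circ> r) [0..<n])"
    if "strict_mono_on {..<n} (u \<circ> r)" for r
    using that by (auto simp: sorted_wrt_iff_nth_less strict_mono_on_def)
  have set: "set (map (u \<circ> r) [0..<n]) = u ` {..<n}" if "r permutes {..<n}" for r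
    using arg_cong[OF permutes_image[OF that], of "(`) u"] by (simp add: image_image atLeast0LessThan)
  have "map (u \<circ> p) [0..<n] = map (u \<circ> q) [0..<n]"
    by (rule strict_sorted_equal) (use p q in \<open>auto intro!: sorted simp del: set_map simp: set\<close>)
  then have *: "u (p i) = u (q i)" if "i < n" for i
    using that by (auto simp: map_eq_conv)
  show "p = q"
  proof
    fix i
    show "p i = q i"
    proof (cases "i < n")
      case True
      then have "p i < n" "q i < n"
        using p q permutes_in_image[of p "{..<n}" i] permutes_in_image[of q "{..<n}" i] by auto
      with * True inj show ?thesis
        by (auto dest: inj_onD)
    next
      case False
      then show ?thesis
        using p q permutes_not_in[of p "{..<n}" i] permutes_not_in[of q "{..<n}" i] by auto
    qed
  qed
qed

text \<open>A product measure is determined by its values on boxes. The preimage of the box with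
  sides \<open>A i\<close> is the box with sides \<open>A (inv p i)\<close>, whose measure is the
  same product with its factors reordered.\<close>

lemma distr_PiM_permute:
  assumes "sigma_finite_measure M" "finite I" and p: "p permutes I"
  shows "distr (\<Pi>\<^sub>M i\<in>I. M) (\<Pi>\<^sub>M i\<in>I. M) (\<lambda>u. \<lambda>i\<in>I. u (p i)) = (\<Pi>\<^sub>M i\<in>I. M)"
proof -
  interpret sigma_finite_measure M by fact
  interpret product_sigma_finite "\<lambda>_. M" by standard
  have pI: "p i \<in> I" if "i \<in> I" for i
    using permutes_in_image[OF p] that by simp
  have [measurable]: "(\<lambda>u. \<lambda>i\<in>I. u (p i)) \<in> (\<Pi>\<^sub>M i\<in>I. M) \<rightarrow>\<^sub>M (\<Pi>\<^sub>M i\<in>I. M)"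
    by (intro measurable_restrict measurable_component_singleton pI)
  let ?q = "Hilbert_Choice.inv p"
  have q: "?q permutes I"
    using p by (rule permutes_inv)
  show ?thesis
  proof (rule PiM_eqI)
    fix A assume A: "\<And>i. i \<in> I \<Longrightarrow> A i \<in> sets M"
    have qI: "?q i \<in> I" if "i \<in> I" for i
      using permutes_in_image[OF q] that by simp
    have "(\<lambda>u. \<lambda>i\<in>I. u (p i)) -` Pi\<^sub>E I A \<inter> space (\<Pi>\<^sub>M i\<in>I. M) = Pi\<^sub>E I (\<lambda>i. A (?q i))"
    proof (intro equalityI subsetI)
      fix u assume u: "u \<in> (\<lambda>u. \<lambda>i\<in>I. u (p i)) -` Pi\<^sub>E I A \<inter> space (\<Pi>\<^sub>M i\<in>I. M)"
      have "u i \<in> A (?q i)" if "i \<in> I" for i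
      proof -
        have "(\<lambda>i\<in>I. u (p i)) \<in> Pi\<^sub>E I A"
          using u by simp
        from PiE_mem[OF this qI[OF that]] show ?thesis
          using qI[OF that] by (simp add: permutes_inverses[OF p])
      qed
      moreover have "u \<in> extensional I"
        using u by (simp add: space_PiM PiE_iff)
      ultimately show "u \<in> Pi\<^sub>E I (\<lambda>i. A (?q i))"
        by (simp add: PiE_iff)
    next
      fix u assume u: "u \<in> Pi\<^sub>E I (\<lambda>i. A (?q i))"
      have "u (p i) \<in> A i" if "i \<in> I" for i
        using PiE_mem[OF u pI[OF that]] by (simp add: permutes_inverses[OF p])
      moreover have "u i \<in> space M" if "i \<in> I" for i
        using PiE_mem[OF u that] A[OF qI[OF that]] sets.sets_into_space by blast
      moreover have "u \<in> extensional I"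
        using u by (simp add: PiE_iff)
      ultimately show "u \<in> (\<lambda>u. \<lambda>i\<in>I. u (p i)) -` Pi\<^sub>E I A \<inter> space (\<Pi>\<^sub>M i\<in>I. M)"
        by (simp add: space_PiM PiE_iff)
    qed
    then have "emeasure (distr (\<Pi>\<^sub>M i\<in>I. M) (\<Pi>\<^sub>M i\<in>I. M) (\<lambda>u. \<lambda>i\<in>I. u (p i))) (Pi\<^sub>E I A) =
        emeasure (\<Pi>\<^sub>M i\<in>I. M) (Pi\<^sub>E I (\<lambda>i. A (?q i)))"
      using A \<open>finite I\<close> by (subst emeasure_distr) (auto intro!: sets_PiM_I_finite)
    also have "\<dots> = (\<Prod>i\<in>I. emeasure M (A (?q i)))"
      using A qI \<open>finite I\<close> by (intro emeasure_PiM) auto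
    also have "\<dots> = (\<Prod>i\<in>I. emeasure M (A i))"
      using prod.permute[OF q, of "\<lambda>i. emeasure M (A i)"] by (simp add: o_def)
    finally show "emeasure (distr (\<Pi>\<^sub>M i\<in>I. M) (\<Pi>\<^sub>M i\<in>I. M) (\<lambda>u. \<lambda>i\<in>I. u (p i))) (Pi\<^sub>E I A) =
        (\<Prod>i\<in>I. emeasure M (A i))" .
  qed (use \<open>finite I\<close> in auto)
qed

lemma has_bochner_integral_PiM_permute:
  fixes f :: "('i \<Rightarrow> 'a) \<Rightarrow> 'b :: {banach, second_countable_topology}"
  assumes "sigma_finite_measure M" "finite I" and p: "p permutes I"
    and [measurable]: "f \<in> borel_measurable (\<Pi>\<^sub>M i\<in>I. M)"
    and "has_bochner_integral (\<Pi>\<^sub>M i\<in>I. M) (\<lambda>u. f (\<lambda>i\<in>I. u (p i))) x"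
  shows "has_bochner_integral (\<Pi>\<^sub>M i\<in>I. M) f x"
proof -
  have "p i \<in> I" if "i \<in> I" for i
    using permutes_in_image[OF p] that by simp
  then have "(\<lambda>u. \<lambda>i\<in>I. u (p i)) \<in> (\<Pi>\<^sub>M i\<in>I. M) \<rightarrow>\<^sub>M (\<Pi>\<^sub>M i\<in>I. M)"
    by (intro measurable_restrict measurable_component_singleton)
  then have "has_bochner_integral (distr (\<Pi>\<^sub>M i\<in>I. M) (\<Pi>\<^sub>M i\<in>I. M) (\<lambda>u. \<lambda>i\<in>I. u (p i))) f x"
    using assms by (intro has_bochner_integral_distr)
  then show ?thesis
    by (simp add: distr_PiM_permute[OF assms(1-3)])
qed

text \<open>
  Andreief's identity. Expanding only \<open>det f\<close> by Leibniz' formula distributes the sum over the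
  permutations onto the chambers of \<open>\<real>\<^sup>n\<close>, so that the integral over one chamber is an integral over
  the whole space.
\<close>

lemma andreief_ordered:
  fixes f g :: "nat \<Rightarrow> real \<Rightarrow> complex"
  assumes [measurable]: "\<And>i. f i \<in> borel_measurable borel" "\<And>i. g i \<in> borel_measurable borel"
    and int: "\<And>i j. i < n \<Longrightarrow> j < n \<Longrightarrow> has_bochner_integral lborel (\<lambda>x. f i x * g j x) (m i j)"
  shows "has_bochner_integral (\<Pi>\<^sub>M i\<in>{..<n}. lborel)
    (\<lambda>u. if strict_mono_on {..<n} u
      then Determinant.det (Matrix.mat n n (\<lambda>(i, j). f j (u i))) *
        Determinant.det (Matrix.mat n n (\<lambda>(i, j). g j (u i)))
      else 0)
    (Determinant.det (Matrix.mat n n (\<lambda>(i, j). m i j)))"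
proof -
  let ?L = "\<Pi>\<^sub>M i\<in>{..<n}. lborel :: real measure"
  let ?P = "{p. p permutes {..<n}}"
  interpret product_sigma_finite "\<lambda>_ :: nat. lborel :: real measure" by standard
  define dg where "dg u = Determinant.det (Matrix.mat n n (\<lambda>(i, j). g j (u i)))" for u
  define h where "h u = (\<Prod>i<n. f i (u i)) * dg u" for u
  have perm_lt: "p i < n" if "p permutes {..<n}" "i < n" for p i
    using permutes_in_image[OF that(1), of i] that(2) by simp
  have comp[measurable]: "(\<lambda>u. u i) \<in> borel_measurable ?L" if "i < n" for i
    using measurable_component_singleton[of i "{..<n}" "\<lambda>_. lborel :: real measure"] that by simp
  have [measurable]: "Measurable.pred ?L (strict_mono_on {..<n})"
    unfolding strict_mono_on_lessThan_iff
    by (intro pred_intros_finite borel_measurable_pred_less comp) auto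
  have dg_measurable: "(\<lambda>u. dg (\<lambda>i. u (p i))) \<in> borel_measurable ?L" if "p permutes {..<n}" for p
    unfolding dg_def det_mat_leibniz using perm_lt[OF that] perm_lt
    by (intro borel_measurable_sum borel_measurable_times borel_measurable_prod
        measurable_compose[OF comp assms(2)] measurable_const) auto
  have h_measurable[measurable]: "(\<lambda>u. h (\<lambda>i. u (p i))) \<in> borel_measurable ?L"
    if "p permutes {..<n}" for p
    unfolding h_def using perm_lt[OF that]
    by (intro borel_measurable_times borel_measurable_prod dg_measurable that
        measurable_compose[OF comp assms(1)]) auto
  have [measurable]: "h \<in> borel_measurable ?L"
    using h_measurable[OF permutes_id] by simp

  \<comment> \<open>\<open>h\<close> keeps only the diagonal term of \<open>det f\<close>. Over the
    whole space the variables separate: each Leibniz term of \<open>dg\<close> gives a product of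
    one-dimensional integrals, and their signed sum is the determinant of \<open>m\<close>.\<close>
  have int_h: "has_bochner_integral ?L h (Determinant.det (Matrix.mat n n (\<lambda>(i, j). m i j)))"
  proof -
    have "has_bochner_integral ?L (\<lambda>u. \<Prod>i<n. f i (u i) * g (p i) (u i)) (\<Prod>i<n. m i (p i))"
      if "p permutes {..<n}" for p
    proof -
      have "has_bochner_integral lborel (\<lambda>x. f i x * g (p i) x) (m i (p i))" if "i < n" for i
        using int that perm_lt[OF \<open>p permutes _\<close> that] by simp
      then show ?thesis
        using product_integrable_prod[of "{..<n}" "\<lambda>i x. f i x * g (p i) x"]
          product_integral_prod[of "{..<n}" "\<lambda>i x. f i x * g (p i) x"]
        by (simp add: has_bochner_integral_iff)
    qed
    then have "has_bochner_integral ?L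
        (\<lambda>u. \<Sum>p\<in>?P. of_int (sign p) * (\<Prod>i<n. f i (u i) * g (p i) (u i)))
        (\<Sum>p\<in>?P. of_int (sign p) * (\<Prod>i<n. m i (p i)))"
      by (intro has_bochner_integral_sum has_bochner_integral_mult_right) auto
    then show ?thesis
      unfolding h_def dg_def det_mat_leibniz
      by (simp add: prod.distrib sum_distrib_left mult_ac)
  qed

  \<comment> \<open>The inverse is chosen so that permuting the coordinates by \<open>p\<close>
    turns the argument of \<open>h\<close> back into \<open>u\<close> and moves the ordered chamber
    to the one that \<open>p\<close> sorts.\<close>
  define t where "t p u = (if strict_mono_on {..<n} u then h (\<lambda>i. u (Hilbert_Choice.inv p i)) else 0)"
    for p u
  have t_permute: "t p (\<lambda>i\<in>{..<n}. u (p i)) = (if strict_mono_on {..<n} (u \<circ> p) then h u else 0)"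
    if p: "p permutes {..<n}" for p u
  proof -
    have "Hilbert_Choice.inv p i < n" if "i < n" for i
      using perm_lt[OF permutes_inv[OF p] that] .
    then have "h (\<lambda>i. (\<lambda>i\<in>{..<n}. u (p i)) (Hilbert_Choice.inv p i)) = h u"
      unfolding h_def dg_def
      by (intro arg_cong2[where f = "(*)"] prod.cong det_mat_cong)
         (auto simp: permutes_inverses[OF p])
    moreover have "strict_mono_on {..<n} (\<lambda>i\<in>{..<n}. u (p i)) \<longleftrightarrow> strict_mono_on {..<n} (u \<circ> p)"
      by (rule strict_mono_on_lessThan_cong) simp
    ultimately show ?thesis
      by (simp add: t_def)
  qed
  \<comment> \<open>This holds pointwise, ties included: if two coordinates agree, two rows of the
    matrix in \<open>dg\<close> agree and \<open>h u = 0\<close>.\<close>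
  have sum_chambers: "(\<Sum>p\<in>?P. if strict_mono_on {..<n} (u \<circ> p) then h u else 0) = h u" for u
  proof (cases "inj_on u {..<n}")
    case True
    then obtain p where p: "p permutes {..<n}"
      "\<And>q. q permutes {..<n} \<Longrightarrow> strict_mono_on {..<n} (u \<circ> q) \<longleftrightarrow> q = p"
      using ex1_sorting_permutation[OF True] by metis
    have "(\<Sum>q\<in>?P. if strict_mono_on {..<n} (u \<circ> q) then h u else 0) = (\<Sum>q\<in>?P. if q = p then h u else 0)"
      by (intro sum.cong) (auto simp: p(2))
    also have "\<dots> = h u"
      using p(1) by (simp add: finite_permutations)
    finally show ?thesis .
  next
    case False
    then obtain i j where "i < n" "j < n" "i \<noteq> j" "u i = u j"
      by (auto simp: inj_on_def)
    then have "dg u = 0"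
      unfolding dg_def by (intro det_mat_equal_rows[of i _ j]) auto
    then have "h u = 0"
      by (simp add: h_def)
    then show ?thesis
      by (simp cong: if_cong)
  qed
  \<comment> \<open>On the ordered chamber, permuting the coordinates changes \<open>dg\<close> only
    by the sign of the permutation; these signs complete the diagonal products to the Leibniz sum
    for \<open>det f\<close>. Summing over inverses is summing over all permutations.\<close>
  have sum_t: "(\<Sum>p\<in>?P. t p u) = (if strict_mono_on {..<n} u
      then Determinant.det (Matrix.mat n n (\<lambda>(i, j). f j (u i))) * dg u else 0)" for u
  proof -
    have h_perm: "h (\<lambda>i. u (p i)) = (of_int (sign p) * (\<Prod>i<n. f i (u (p i)))) * dg u"
      if "p permutes {..<n}" for p
      unfolding h_def dg_def using det_permute_rows_lessThan[OF that, of "\<lambda>i j. g j (u i)"]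
      by (simp add: mult_ac)
    have "(\<Sum>p\<in>?P. h (\<lambda>i. u (Hilbert_Choice.inv p i))) = (\<Sum>p\<in>?P. h (\<lambda>i. u (p i)))"
      by (rule sum_permutations_inverse[symmetric])
    also have "\<dots> = (\<Sum>p\<in>?P. (of_int (sign p) * (\<Prod>i<n. f i (u (p i)))) * dg u)"
      by (intro sum.cong) (auto simp: h_perm)
    also have "\<dots> = Determinant.det (Matrix.mat n n (\<lambda>(i, j). f j (u i))) * dg u"
      unfolding det_mat_leibniz_columns by (simp add: sum_distrib_right)
    finally show ?thesis
      by (simp add: t_def)
  qed

  \<comment> \<open>\<open>?c p\<close> is \<open>h\<close> cut down to one chamber, hence dominated
    by \<open>h\<close> and integrable. It is also \<open>t p\<close> with permuted coordinates, so
    both have the same integral.\<close>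
  let ?c = "\<lambda>p u. if strict_mono_on {..<n} (u \<circ> p) then h u else 0"
  have int_c: "has_bochner_integral ?L (?c p) (integral\<^sup>L ?L (?c p))" and
    int_t: "has_bochner_integral ?L (t p) (integral\<^sup>L ?L (?c p))"
    if p: "p permutes {..<n}" for p
  proof -
    have "(\<lambda>u. \<lambda>i\<in>{..<n}. u (p i)) \<in> ?L \<rightarrow>\<^sub>M ?L"
      using perm_lt[OF p] by (intro measurable_restrict measurable_component_singleton) auto
    moreover have t_measurable: "t p \<in> borel_measurable ?L"
      unfolding t_def using h_measurable[OF permutes_inv[OF p]] by measurable
    ultimately have "(\<lambda>u. t p (\<lambda>i\<in>{..<n}. u (p i))) \<in> borel_measurable ?L"
      by (rule measurable_compose)
    then have "?c p \<in> borel_measurable ?L"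
      by (simp only: t_permute[OF p])
    moreover have "integrable ?L h"
      using int_h by (rule integrable.intros)
    ultimately show *: "has_bochner_integral ?L (?c p) (integral\<^sup>L ?L (?c p))"
      by (intro has_bochner_integral_integrable Bochner_Integration.integrable_bound[of ?L h "?c p"])
         auto
    show "has_bochner_integral ?L (t p) (integral\<^sup>L ?L (?c p))"
      by (rule has_bochner_integral_PiM_permute[OF _ _ p t_measurable])
         (use * in \<open>auto simp only: t_permute[OF p] intro: lborel.sigma_finite_measure_axioms\<close>)
  qed
  \<comment> \<open>The \<open>?c p\<close> add up to \<open>h\<close>, the \<open>t p\<close> to
    the ordered integrand, and the two sums of integrals agree term by term.\<close>
  have "has_bochner_integral ?L (\<lambda>u. \<Sum>p\<in>?P. ?c p u) (\<Sum>p\<in>?P. integral\<^sup>L ?L (?c p))"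
    by (intro has_bochner_integral_sum int_c) auto
  then have "(\<Sum>p\<in>?P. integral\<^sup>L ?L (?c p)) = Determinant.det (Matrix.mat n n (\<lambda>(i, j). m i j))"
    using int_h by (simp only: sum_chambers) (rule has_bochner_integral_eq)
  moreover have "has_bochner_integral ?L (\<lambda>u. \<Sum>p\<in>?P. t p u) (\<Sum>p\<in>?P. integral\<^sup>L ?L (?c p))"
    by (intro has_bochner_integral_sum int_t) auto
  ultimately show ?thesis
    by (simp only: sum_t dg_def)
qed

subsection \<open>Complex Gamma and Beta integrals\<close>

text \<open>The cutoff at \<open>0\<close> turns integrals over the half-line into integrals over
  \<open>lborel\<close>, and lets \<open>powr_pos z x * powr_pos w (u - x)\<close> be supported in
  \<open>0 < x < u\<close> by itself.\<close>

definition powr_pos :: "complex \<Rightarrow> real \<Rightarrow> complex" where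
  "powr_pos z x = (if 0 < x then complex_of_real x powr z else 0)"

lemma powr_pos_measurable[measurable]: "powr_pos z \<in> borel_measurable borel"
proof -
  have "powr_pos z = (\<lambda>x. if 0 < x then exp (z * complex_of_real (ln x)) else 0)"
    by (auto simp: powr_pos_def powr_def Ln_of_real)
  also have "\<dots> \<in> borel_measurable borel"
    by measurable
  finally show ?thesis .
qed

lemma norm_powr_pos: "norm (powr_pos z x) = (if 0 < x then x powr Re z else 0)"
  by (simp add: powr_pos_def norm_powr_real_powr)

lemma powr_pos_mult:
  assumes "0 < c"
  shows "powr_pos z (c * x) = complex_of_real c powr z * powr_pos z x"
  using assms by (simp add: powr_pos_def powr_times_real zero_less_mult_iff)

text \<open>Euler's integral is absolutely integrable with respect to \<open>lebesgue\<close>; the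
  integrand is Borel, so passing from this completion to \<open>lborel\<close> changes neither
  integrability nor value.\<close>

lemma has_bochner_integral_Gamma:
  assumes "Re z > 0"
  shows "has_bochner_integral lborel (\<lambda>x. powr_pos (z - 1) x * complex_of_real (exp (- x))) (Gamma z)"
proof -
  let ?f = "\<lambda>t. complex_of_real t powr (z - 1) / of_real (exp t)"
  have f: "(\<lambda>x. powr_pos (z - 1) x * complex_of_real (exp (- x))) = (\<lambda>x. indicator {0<..} x *\<^sub>R ?f x)"
    by (auto simp: powr_pos_def indicator_def exp_minus field_simps)
  have abs: "set_integrable lebesgue {0<..} ?f"
    using absolutely_integrable_Gamma_integral'[OF assms] .
  have "(LINT x:{0<..}|lebesgue. ?f x) = integral {0<..} ?f"
    using set_lebesgue_integral_eq_integral(2)[OF abs] .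
  also have "\<dots> = Gamma z"
    using Gamma_integral_complex'[OF assms] by (rule integral_unique)
  finally have "has_bochner_integral lebesgue (\<lambda>x. powr_pos (z - 1) x * complex_of_real (exp (- x))) (Gamma z)"
    using abs unfolding has_bochner_integral_iff f set_integrable_def set_lebesgue_integral_def by simp
  then show ?thesis
    unfolding has_bochner_integral_iff by (simp add: integrable_completion integral_completion)
qed

text \<open>Substitution \<open>x = \<theta> t\<close>: the power contributes
  \<open>\<theta>\<close> to the exponent \<open>z - 1\<close>, the Jacobian one further factor
  \<open>\<theta>\<close>.\<close>

lemma has_bochner_integral_Gamma_scaled:
  assumes "Re z > 0" "\<theta> > 0"
  shows "has_bochner_integral lborel (\<lambda>x. powr_pos (z - 1) x * complex_of_real (exp (- x / \<theta>)))
    (complex_of_real \<theta> powr z * Gamma z)"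
proof -
  have "complex_of_real \<theta> powr (z - 1) * Gamma z = (complex_of_real \<theta> powr z * Gamma z) /\<^sub>R \<bar>\<theta>\<bar>"
    using assms by (simp add: powr_diff scaleR_conv_of_real divide_inverse mult_ac)
  moreover have "has_bochner_integral lborel
      (\<lambda>x. complex_of_real \<theta> powr (z - 1) * (powr_pos (z - 1) x * complex_of_real (exp (- x))))
      (complex_of_real \<theta> powr (z - 1) * Gamma z)"
    by (intro has_bochner_integral_mult_right has_bochner_integral_Gamma assms)
  moreover have "powr_pos (z - 1) (0 + \<theta> * x) * complex_of_real (exp (- (0 + \<theta> * x) / \<theta>)) =
      complex_of_real \<theta> powr (z - 1) * (powr_pos (z - 1) x * complex_of_real (exp (- x)))" for x
    using assms by (simp add: powr_pos_mult mult.assoc)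
  ultimately show ?thesis
    using assms(2)
    by (subst lborel_has_bochner_integral_real_affine_iff[where c = \<theta> and t = 0])
       (simp_all add: mult.assoc)
qed

lemma Gamma_nonzero:
  assumes "Re w > 0"
  shows "Gamma w \<noteq> 0"
  using assms by (auto simp: Gamma_eq_zero_iff elim!: nonpos_Ints_cases)

lemma integrable_Beta_complex:
  assumes "Re z > 0" "Re w > 0"
  shows "integrable lborel (\<lambda>x. powr_pos (z - 1) x * powr_pos (w - 1) (1 - x))"
proof (rule Bochner_Integration.integrable_bound)
  show "integrable lborel (\<lambda>x. indicator {0..1} x *\<^sub>R (x powr (Re z - 1) * (1 - x) powr (Re w - 1)))"
    using integrable_Beta[OF assms] by (simp add: set_integrable_def)
  show "AE x in lborel. norm (powr_pos (z - 1) x * powr_pos (w - 1) (1 - x))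
      \<le> norm (indicator {0..1} x *\<^sub>R (x powr (Re z - 1) * (1 - x) powr (Re w - 1)))"
    by (intro AE_I2) (auto simp: norm_mult norm_powr_pos indicator_def)
qed measurable

text \<open>For \<open>u > 0\<close> substitute \<open>x = u t\<close>; for \<open>u \<le> 0\<close>
  the supports of the two factors are disjoint. Where the integral diverges, both sides take the
  default value \<open>0\<close>.\<close>

lemma powr_pos_convolution:
  fixes z w :: complex and u :: real
  shows "(\<integral>x. powr_pos (z - 1) x * powr_pos (w - 1) (u - x) \<partial>lborel) =
    powr_pos (z + w - 1) u * (\<integral>x. powr_pos (z - 1) x * powr_pos (w - 1) (1 - x) \<partial>lborel)"
proof (cases "u > 0")
  case True
  have scale: "powr_pos (w - 1) (u - (0 + u * x)) =
      complex_of_real u powr (w - 1) * powr_pos (w - 1) (1 - x)" for x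
    by (simp add: powr_pos_mult[OF True, symmetric] algebra_simps)
  have "powr_pos (z - 1) (0 + u * x) * powr_pos (w - 1) (u - (0 + u * x)) =
      (complex_of_real u powr (z - 1) * complex_of_real u powr (w - 1)) *
        (powr_pos (z - 1) x * powr_pos (w - 1) (1 - x))" for x
    unfolding scale by (simp add: powr_pos_mult[OF True] mult_ac)
  then have "(\<integral>x. powr_pos (z - 1) x * powr_pos (w - 1) (u - x) \<partial>lborel) =
      u *\<^sub>R (\<integral>x. (complex_of_real u powr (z - 1) * complex_of_real u powr (w - 1)) *
        (powr_pos (z - 1) x * powr_pos (w - 1) (1 - x)) \<partial>lborel)"
    using True by (subst lborel_integral_real_affine[where c = u and t = 0]) simp_all
  also have "\<dots> = (u * complex_of_real u powr (z - 1) * complex_of_real u powr (w - 1)) *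
      (\<integral>x. powr_pos (z - 1) x * powr_pos (w - 1) (1 - x) \<partial>lborel)"
    by (subst integral_mult_right_zero) (simp add: scaleR_conv_of_real mult_ac)
  also have "u * complex_of_real u powr (z - 1) * complex_of_real u powr (w - 1) = powr_pos (z + w - 1) u"
    using True by (simp add: powr_pos_def powr_add powr_diff)
  finally show ?thesis .
next
  case False
  then have "(\<lambda>x. powr_pos (z - 1) x * powr_pos (w - 1) (u - x)) = (\<lambda>_. 0)"
    by (auto simp: powr_pos_def)
  with False show ?thesis
    by (simp add: powr_pos_def)
qed

text \<open>Fubini for \<open>F x u\<close>, the convolution integrand times
  \<open>exp (- u)\<close>: integrating over \<open>u\<close> first gives
  \<open>Gamma z * Gamma w\<close>, integrating over \<open>x\<close> first gives
  \<open>Gamma (z + w)\<close> times the Beta integral.\<close>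

lemma has_bochner_integral_Beta:
  assumes "Re z > 0" "Re w > 0"
  shows "has_bochner_integral lborel (\<lambda>x. powr_pos (z - 1) x * powr_pos (w - 1) (1 - x)) (Beta z w)"
proof -
  define B where "B = (\<integral>x. powr_pos (z - 1) x * powr_pos (w - 1) (1 - x) \<partial>lborel)"
  define F where "F x u = powr_pos (z - 1) x * (powr_pos (w - 1) (u - x) * complex_of_real (exp (- u)))"
    for x u
  have [measurable]: "case_prod F \<in> borel_measurable (lborel \<Otimes>\<^sub>M lborel)"
    unfolding F_def by measurable
  have inner: "has_bochner_integral lborel (F x)
      (powr_pos (z - 1) x * complex_of_real (exp (- x)) * Gamma w)"
    and inner_norm: "(\<integral>u. norm (F x u) \<partial>lborel) =
      norm (powr_pos (z - 1) x * complex_of_real (exp (- x))) *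
        (\<integral>u. norm (powr_pos (w - 1) u * complex_of_real (exp (- u))) \<partial>lborel)" for x
  proof -
    \<comment> \<open>Translating \<open>u\<close> by \<open>x\<close> separates the variables; the
      same computation for norms supplies the integrability that Fubini requires.\<close>
    have shift: "F x (x + u) = (powr_pos (z - 1) x * complex_of_real (exp (- x))) *
        (powr_pos (w - 1) u * complex_of_real (exp (- u)))" for u
      by (simp add: F_def exp_add exp_diff exp_minus field_simps)
    show "has_bochner_integral lborel (F x)
        (powr_pos (z - 1) x * complex_of_real (exp (- x)) * Gamma w)"
      by (subst lborel_has_bochner_integral_real_affine_iff[where c = 1 and t = x])
         (auto simp: shift intro!: has_bochner_integral_mult_right has_bochner_integral_Gamma assms)
    show "(\<integral>u. norm (F x u) \<partial>lborel) =
        norm (powr_pos (z - 1) x * complex_of_real (exp (- x))) *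
          (\<integral>u. norm (powr_pos (w - 1) u * complex_of_real (exp (- u))) \<partial>lborel)"
      by (subst lborel_integral_real_affine[where c = 1 and t = x]) (simp_all add: shift norm_mult)
  qed
  have "integrable (lborel \<Otimes>\<^sub>M lborel) (case_prod F)"
  proof (rule lborel_pair.Fubini_integrable)
    show "integrable lborel (\<lambda>x. \<integral>u. norm (case_prod F (x, u)) \<partial>lborel)"
      using has_bochner_integral_Gamma[OF assms(1)]
      by (auto simp: inner_norm has_bochner_integral_iff intro!: integrable_mult_left integrable_norm)
    show "AE x in lborel. integrable lborel (\<lambda>u. case_prod F (x, u))"
      using inner by (auto simp: has_bochner_integral_iff)
  qed measurable
  then have "(\<integral>u. (\<integral>x. F x u \<partial>lborel) \<partial>lborel) = (\<integral>x. (\<integral>u. F x u \<partial>lborel) \<partial>lborel)"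
    by (rule lborel_pair.Fubini_integral)
  also have "\<dots> = (\<integral>x. powr_pos (z - 1) x * complex_of_real (exp (- x)) * Gamma w \<partial>lborel)"
    using inner by (simp add: has_bochner_integral_iff)
  also have "\<dots> = Gamma z * Gamma w"
    using has_bochner_integral_Gamma[OF assms(1)] by (simp add: has_bochner_integral_iff)
  finally have fubini: "(\<integral>u. (\<integral>x. F x u \<partial>lborel) \<partial>lborel) = Gamma z * Gamma w" .
  have "(\<integral>x. F x u \<partial>lborel) = powr_pos (z + w - 1) u * complex_of_real (exp (- u)) * B" for u
  proof -
    have "(\<integral>x. F x u \<partial>lborel) =
        (\<integral>x. powr_pos (z - 1) x * powr_pos (w - 1) (u - x) \<partial>lborel) * complex_of_real (exp (- u))"
      unfolding F_def mult.assoc[symmetric] by (rule integral_mult_left_zero)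
    also have "\<dots> = powr_pos (z + w - 1) u * B * complex_of_real (exp (- u))"
      unfolding B_def by (subst powr_pos_convolution) (rule refl)
    finally show ?thesis
      by (simp add: mult_ac)
  qed
  then have "(\<integral>u. (\<integral>x. F x u \<partial>lborel) \<partial>lborel) = Gamma (z + w) * B"
    using has_bochner_integral_Gamma[of "z + w"] assms by (simp add: has_bochner_integral_iff)
  with fubini have "Gamma z * Gamma w = Gamma (z + w) * B" by simp
  moreover have "Gamma (z + w) \<noteq> 0"
    by (rule Gamma_nonzero) (use assms in simp)
  ultimately have "B = Beta z w"
    by (simp add: Beta_def field_simps)
  then show ?thesis
    using integrable_Beta_complex[OF assms] by (simp add: has_bochner_integral_iff B_def)
qed

subsection \<open>The Selberg and Laguerre ensembles\<close>

lemma powr_pos_times_power: "powr_pos z x * complex_of_real x ^ j = powr_pos (z + of_nat j) x"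
  by (simp add: powr_pos_def powr_add powr_nat')

text \<open>\<open>vandermonde_pow\<close> is evaluated at vectors of any sign, hence the argument
  \<open>pi\<close> of the principal logarithm for \<open>x < 0\<close> and the value
  \<open>0\<close> at \<open>x = 0\<close>.\<close>

lemma complex_of_real_powr_measurable[measurable]:
  "(\<lambda>x. complex_of_real x powr z) \<in> borel_measurable borel"
proof -
  have "(\<lambda>x. complex_of_real x powr z) =
      (\<lambda>x. if x = 0 then 0 else exp (z * (complex_of_real (ln \<bar>x\<bar>) + (if x < 0 then pi else 0) * \<i>)))"
    by (rule ext) (simp add: powr_def Ln_of_real')
  also have "\<dots> \<in> borel_measurable borel"
    by measurable
  finally show ?thesis .
qed

lemma vandermonde_pow_measurable:
  "vandermonde_pow n z \<in> borel_measurable (\<Pi>\<^sub>M i\<in>{..<n}. lborel)"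
proof -
  have comp: "(\<lambda>u. u i) \<in> borel_measurable (\<Pi>\<^sub>M i\<in>{..<n}. lborel)" if "i < n" for i
    using measurable_component_singleton[of i "{..<n}" "\<lambda>_. lborel :: real measure"] that by simp
  have entry: "(\<lambda>x. if j = 0 then complex_of_real x powr (- z) else complex_of_real x ^ j)
      \<in> borel_measurable borel" for j :: nat
    by measurable
  have "vandermonde_pow n z = (\<lambda>u. \<Sum>p | p permutes {..<n}. of_int (sign p) * (\<Prod>i<n.
      if p i = 0 then complex_of_real (u i) powr (- z) else complex_of_real (u i) ^ p i))"
    unfolding vandermonde_pow_def det_mat_leibniz ..
  also have "\<dots> \<in> borel_measurable (\<Pi>\<^sub>M i\<in>{..<n}. lborel)"
    by (intro borel_measurable_sum borel_measurable_times borel_measurable_prod borel_measurable_const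
        measurable_compose[OF comp entry]) auto
  finally show ?thesis .
qed

text \<open>Entries equal to \<open>0\<close> are excluded because \<open>0 powr 0 = 0\<close>,
  whereas the Vandermonde matrix has \<open>0 ^ 0 = 1\<close> in its first column.\<close>

lemma vandermonde_pow_0:
  assumes "inj_on u {..<n}" "\<And>i. i < n \<Longrightarrow> u i \<noteq> 0"
  shows "vandermonde_pow n 0 u = complex_of_real (vandermonde_prod n u)"
proof -
  have "vandermonde_pow n 0 u =
      Determinant.det (Matrix.mat n n (\<lambda>(i, j). complex_of_real (u i) ^ j))"
    unfolding vandermonde_pow_def using assms(2) by (intro det_mat_cong) auto
  also have "\<dots> = (\<Prod>j<n. \<Prod>i<j. complex_of_real (u j) - complex_of_real (u i))"
    using assms(1) by (intro det_vandermonde) (auto simp: inj_on_def)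
  finally show ?thesis
    by (simp add: vandermonde_prod_def)
qed

lemma vandermonde_prod_nonzero:
  assumes "inj_on u {..<n}"
  shows "vandermonde_prod n u \<noteq> 0"
  using assms unfolding vandermonde_prod_def by (force simp: inj_on_def)

text \<open>The law of the unconscious statistician for a density, with integrability
  included.\<close>

lemma (in prob_space) has_bochner_integral_distributed:
  fixes f :: "'b \<Rightarrow> 'c :: {banach, second_countable_topology}"
  assumes D: "distributed M L X (\<lambda>x. ennreal (d x))" and d: "\<And>x. 0 \<le> d x"
    and f: "f \<in> borel_measurable L"
    and int: "has_bochner_integral L (\<lambda>x. d x *\<^sub>R f x) v"
  shows "has_bochner_integral M (\<lambda>\<omega>. f (X \<omega>)) v"
proof -
  have "d \<in> borel_measurable L"
    by (rule distributed_real_measurable[OF _ D]) (rule d)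
  then have "has_bochner_integral (density L (\<lambda>x. ennreal (d x))) f v"
    using f int d by (intro has_bochner_integral_density) auto
  then have "has_bochner_integral (distr M L X) f v"
    by (simp add: distributed_distr_eq_density[OF D])
  then show ?thesis
    using f distributed_measurable[OF D]
    by (simp add: has_bochner_integral_iff integrable_distr_eq integral_distr)
qed

text \<open>
  The normalising constant \<open>K\<close> is never evaluated: the total mass \<open>1\<close> of the density is itself \<open>K\<close>
  times the determinant of moments at \<open>z = 0\<close>.
\<close>

lemma (in prob_space) vandermonde_ratio_expectation:
  fixes W :: "real \<Rightarrow> real" and q :: "nat \<Rightarrow> complex poly" and G :: "complex \<Rightarrow> complex"
  assumes "n > 0" and [measurable]: "W \<in> borel_measurable borel"
    and W: "\<And>x. 0 \<le> W x" "\<And>x. x \<le> 0 \<Longrightarrow> W x = 0" and "0 \<le> K"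
    and D: "distributed M (\<Pi>\<^sub>M i\<in>{..<n}. lborel) U (\<lambda>u. ennreal (if strict_mono_on {..<n} u
      then K * (vandermonde_prod n u)\<^sup>2 * (\<Prod>i<n. W (u i)) else 0))"
    and deg: "\<And>j. j < n \<Longrightarrow> degree (q j) \<le> n - 1"
    and G: "\<And>i. i < n \<Longrightarrow> G (- of_nat i) \<noteq> 0"
    and moment: "\<And>y j. y \<in> insert z ((\<lambda>i. - of_nat i) ` {..<n}) \<Longrightarrow> j < n \<Longrightarrow>
      has_bochner_integral lborel (\<lambda>x. powr_pos (of_nat j - y) x * complex_of_real (W x))
        (G y * poly (q j) y)"
  shows "has_bochner_integral M (\<lambda>\<omega>. vandermonde_pow n z (U \<omega>) / vandermonde_pow n 0 (U \<omega>))
    (G z / G 0 * (\<Prod>k=1..n-1. 1 + z / of_nat k))"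
proof -
  let ?L = "\<Pi>\<^sub>M i\<in>{..<n}. lborel :: real measure"
  define d where "d u = (if strict_mono_on {..<n} u
      then K * (vandermonde_prod n u)\<^sup>2 * (\<Prod>i<n. W (u i)) else 0)" for u
  have d_nonneg: "0 \<le> d u" for u
    using \<open>0 \<le> K\<close> W(1) by (simp add: d_def prod_nonneg)
  have D: "distributed M ?L U (\<lambda>u. ennreal (d u))"
    using D by (simp only: d_def)
  note transfer = has_bochner_integral_distributed[OF D d_nonneg]
  define c where "c i j = G (- of_nat i) * poly (q j) (- of_nat i)" for i j
  define \<Delta> where
    "\<Delta> y = Determinant.det (Matrix.mat n n (\<lambda>(i, j). if i = 0 then G y * poly (q j) y else c i j))" for y

  \<comment> \<open>One of the two Vandermonde factors in the density cancels the denominator and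
    the other is \<open>det g\<close>; the numerator together with the weights is
    \<open>det f\<close>. The claim covers both \<open>y = z\<close> and \<open>y = 0\<close>, the
    latter for the total mass.\<close>
  have ratio: "has_bochner_integral ?L (\<lambda>u. d u *\<^sub>R (vandermonde_pow n y u / vandermonde_pow n 0 u))
      (complex_of_real K * \<Delta> y)"
    if y: "y \<in> insert z ((\<lambda>i. - of_nat i) ` {..<n})" for y
  proof -
    \<comment> \<open>The whole weight goes into \<open>f\<close>, leaving plain monomials for
      \<open>g\<close>. Then \<open>f i * g j\<close> has exponent \<open>j - y\<close> for
      \<open>i = 0\<close> and \<open>j + i\<close> otherwise, which is the moment at
      \<open>- i\<close>.\<close>
    define f where "f i x = (if i = 0 then powr_pos (- y) x else powr_pos (of_nat i) x) * complex_of_real (W x)"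
      for i x
    define g where "g j x = complex_of_real x ^ j" for j x
    have [measurable]: "f i \<in> borel_measurable borel" "g i \<in> borel_measurable borel" for i
      unfolding f_def g_def by measurable
    have fg: "f i x * g j x = powr_pos (of_nat j - (if i = 0 then y else - of_nat i)) x * complex_of_real (W x)"
      for i j x
      using powr_pos_times_power[of "- y" x j] powr_pos_times_power[of "of_nat i" x j]
      by (simp add: f_def g_def add.commute mult_ac)
    have "has_bochner_integral lborel (\<lambda>x. f i x * g j x) (if i = 0 then G y * poly (q j) y else c i j)"
      if "i < n" "j < n" for i j
      using moment[of "if i = 0 then y else - of_nat i" j] that y unfolding fg c_def by auto
    then have "has_bochner_integral ?L
        (\<lambda>u. if strict_mono_on {..<n} u
          then Determinant.det (Matrix.mat n n (\<lambda>(i, j). f j (u i))) *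
            Determinant.det (Matrix.mat n n (\<lambda>(i, j). g j (u i)))
          else 0) (\<Delta> y)"
      unfolding \<Delta>_def by (intro andreief_ordered) auto
    then have "has_bochner_integral ?L
        (\<lambda>u. complex_of_real K * (if strict_mono_on {..<n} u
          then Determinant.det (Matrix.mat n n (\<lambda>(i, j). f j (u i))) *
            Determinant.det (Matrix.mat n n (\<lambda>(i, j). g j (u i)))
          else 0)) (complex_of_real K * \<Delta> y)"
      by (rule has_bochner_integral_mult_right)
    moreover have "complex_of_real K * (if strict_mono_on {..<n} u
          then Determinant.det (Matrix.mat n n (\<lambda>(i, j). f j (u i))) *
            Determinant.det (Matrix.mat n n (\<lambda>(i, j). g j (u i)))
          else 0) = d u *\<^sub>R (vandermonde_pow n y u / vandermonde_pow n 0 u)" for u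
    proof (cases "strict_mono_on {..<n} u")
      case True
      then have inj: "inj_on u {..<n}"
        by (rule strict_mono_on_imp_inj_on)
      have "Determinant.det (Matrix.mat n n (\<lambda>(i, j). f j (u i))) =
          Determinant.det (Matrix.mat n n (\<lambda>(i, j). complex_of_real (W (u i)) *
            (if j = 0 then powr_pos (- y) (u i) else powr_pos (of_nat j) (u i))))"
        by (rule det_mat_cong) (simp add: f_def)
      also have "\<dots> = complex_of_real (\<Prod>i<n. W (u i)) *
          Determinant.det (Matrix.mat n n (\<lambda>(i, j).
            if j = 0 then powr_pos (- y) (u i) else powr_pos (of_nat j) (u i)))"
        by (simp add: det_scale_rows)
      finally have det_f: "Determinant.det (Matrix.mat n n (\<lambda>(i, j). f j (u i))) =
          complex_of_real (\<Prod>i<n. W (u i)) * Determinant.det (Matrix.mat n n (\<lambda>(i, j).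
            if j = 0 then powr_pos (- y) (u i) else powr_pos (of_nat j) (u i)))" .
      show ?thesis
      proof (cases "\<forall>i<n. 0 < u i")
        case pos: True
        have "Determinant.det (Matrix.mat n n (\<lambda>(i, j).
            if j = 0 then powr_pos (- y) (u i) else powr_pos (of_nat j) (u i))) = vandermonde_pow n y u"
          unfolding vandermonde_pow_def using pos
          by (intro det_mat_cong) (auto simp: powr_pos_def powr_nat')
        moreover have "Determinant.det (Matrix.mat n n (\<lambda>(i, j). g j (u i))) =
            complex_of_real (vandermonde_prod n u)"
          unfolding vandermonde_prod_def g_def using inj
          by (subst det_vandermonde) (auto simp: inj_on_def)
        moreover have "vandermonde_pow n 0 u = complex_of_real (vandermonde_prod n u)"
          using inj pos by (intro vandermonde_pow_0) auto
        ultimately show ?thesis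
          using True det_f vandermonde_prod_nonzero[OF inj]
          by (simp add: d_def scaleR_conv_of_real power2_eq_square field_simps)
      next
        case False
        \<comment> \<open>Outside the positive orthant a weight vanishes, so both sides are
          \<open>0\<close> whatever the cut-off powers are there.\<close>
        then have "(\<Prod>i<n. W (u i)) = 0"
          using W(2) by (auto simp: not_less)
        then show ?thesis
          unfolding det_f d_def by (simp del: of_real_prod prod_zero_iff)
      qed
    qed (simp add: d_def)
    ultimately show ?thesis
      by (simp only:)
  qed

  \<comment> \<open>The quotient is \<open>1\<close> only where its denominator is nonzero, since
    \<open>0 / 0 = 0\<close>; this is the case wherever the density is nonzero.\<close>
  have one: "d u *\<^sub>R (vandermonde_pow n 0 u / vandermonde_pow n 0 u) = d u *\<^sub>R (1 :: complex)" for u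
  proof (cases "d u = 0")
    case False
    then have "strict_mono_on {..<n} u"
      by (auto simp: d_def split: if_splits)
    then have inj: "inj_on u {..<n}"
      by (rule strict_mono_on_imp_inj_on)
    have "u i \<noteq> 0" if "i < n" for i
      using False that W(2)[of "u i"] by (auto simp: d_def split: if_splits)
    then show ?thesis
      using vandermonde_pow_0[OF inj] vandermonde_prod_nonzero[OF inj] by simp
  qed simp
  have "0 \<in> insert z ((\<lambda>i. - of_nat i) ` {..<n})"
    using \<open>n > 0\<close> by force
  from ratio[OF this]
  have "has_bochner_integral ?L (\<lambda>u. d u *\<^sub>R (1 :: complex)) (complex_of_real K * \<Delta> 0)"
    by (simp only: one)
  then have "has_bochner_integral M (\<lambda>\<omega>. 1) (complex_of_real K * \<Delta> 0)"
    by (intro transfer) auto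
  then have mass: "complex_of_real K * \<Delta> 0 = 1"
    by (simp add: has_bochner_integral_iff prob_space)

  have "\<Delta> 0 = Determinant.det (Matrix.mat n n (\<lambda>(i, j). c i j))"
    unfolding \<Delta>_def by (rule det_mat_cong) (simp add: c_def)
  then have "G 0 * \<Delta> z = G z * (\<Prod>k=1..n-1. 1 + z / of_nat k) * \<Delta> 0"
    using det_interpolated_row[where q = q and G = G and c = c and b = "\<lambda>j. G z * poly (q j) z" and z = z,
        OF \<open>n > 0\<close> deg c_def G refl]
    by (simp only: \<Delta>_def[of z])
  \<comment> \<open>Multiplying by \<open>K\<close> lets the total mass
    \<open>K * \<Delta> 0 = 1\<close> eliminate \<open>\<Delta> 0\<close>.\<close>
  then have "complex_of_real K * (G 0 * \<Delta> z) =
      G z * (\<Prod>k=1..n-1. 1 + z / of_nat k) * (complex_of_real K * \<Delta> 0)"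
    by (simp add: mult_ac)
  then have "complex_of_real K * \<Delta> z = G z / G 0 * (\<Prod>k=1..n-1. 1 + z / of_nat k)"
    using mass G[of 0] \<open>n > 0\<close> by (simp add: field_simps)
  moreover have "(\<lambda>u. vandermonde_pow n z u / vandermonde_pow n 0 u) \<in> borel_measurable ?L"
    by (intro borel_measurable_divide vandermonde_pow_measurable)
  then have "has_bochner_integral M (\<lambda>\<omega>. vandermonde_pow n z (U \<omega>) / vandermonde_pow n 0 (U \<omega>))
      (complex_of_real K * \<Delta> z)"
    using ratio[of z] by (intro transfer) auto
  ultimately show ?thesis
    by simp
qed

text \<open>The product of the \<open>1 + 1 / n\<close> for \<open>n\<close> from \<open>1\<close>
  to \<open>m\<close> telescopes to \<open>m + 1\<close>, and complex powers of positive reals are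
  multiplicative.\<close>

lemma recip_Gamma_trunc_times_powr:
  "recip_Gamma_trunc m z * of_nat (Suc m) powr z = (\<Prod>k=1..m. 1 + z / of_nat k)"
proof (induction m)
  case 0
  then show ?case by (simp add: recip_Gamma_trunc_def)
next
  case (Suc m)
  define r where "r = complex_of_real (1 + 1 / real (Suc m))"
  have "real (Suc (Suc m)) = (1 + 1 / real (Suc m)) * real (Suc m)"
    by (simp add: distrib_right del: of_nat_Suc)
  then have "of_nat (Suc (Suc m)) = r * (of_nat (Suc m) :: complex)"
    unfolding r_def by (metis of_real_mult of_real_of_nat_eq)
  then have "of_nat (Suc (Suc m)) powr z = r powr z * of_nat (Suc m) powr z"
    by (simp only:) (rule powr_times_real, auto simp: r_def)
  moreover have "r powr (- z) * r powr z = 1"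
  proof -
    have "1 + 1 / real (Suc m) > 0"
      by (simp add: add_pos_nonneg)
    then have "r \<noteq> 0"
      unfolding r_def of_real_eq_0_iff by linarith
    then show ?thesis
      by (simp add: powr_minus)
  qed
  moreover have "recip_Gamma_trunc (Suc m) z =
      recip_Gamma_trunc m z * ((1 + z / of_nat (Suc m)) * r powr (- z))"
    by (simp add: recip_Gamma_trunc_def r_def)
  ultimately have "recip_Gamma_trunc (Suc m) z * of_nat (Suc (Suc m)) powr z =
      (recip_Gamma_trunc m z * of_nat (Suc m) powr z) * (1 + z / of_nat (Suc m))"
    by (simp add: mult_ac)
  then show ?case
    by (simp only: Suc.IH) simp
qed

text \<open>The rising factorial of \<open>c - y\<close> of length \<open>k\<close>, as a polynomial
  in \<open>y\<close>.\<close>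

definition pochhammer_poly :: "complex \<Rightarrow> nat \<Rightarrow> complex poly" where
  "pochhammer_poly c k = (\<Prod>i<k. [:c + of_nat i, -1:])"

lemma poly_pochhammer_poly: "poly (pochhammer_poly c k) y = pochhammer (c - y) k"
  by (simp add: pochhammer_poly_def pochhammer_prod poly_prod atLeast0LessThan algebra_simps)

lemma degree_pochhammer_poly: "degree (pochhammer_poly c k) \<le> k"
proof -
  have "degree (pochhammer_poly c k) \<le> (\<Sum>i<k. 1)"
    unfolding pochhammer_poly_def by (rule order.trans[OF degree_prod_sum_le sum_mono]) auto
  then show ?thesis by simp
qed

lemma Gamma_plus_of_nat:
  assumes "Re w > 0"
  shows "Gamma (w + of_nat k) = pochhammer w k * Gamma w"
proof -
  have "w \<notin> \<int>\<^sub>\<le>\<^sub>0"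
    using assms by (auto elim!: nonpos_Ints_cases)
  then show ?thesis
    by (simp add: pochhammer_Gamma Gamma_eq_zero_iff)
qed

theorem theorem6:
  fixes M :: "'a measure" and U :: "'a \<Rightarrow> nat \<Rightarrow> real"
    and N :: nat and a b \<theta> :: real and s :: complex
  assumes "prob_space M"
    and "N \<ge> 2" and "a > 0" and "b > 0" and "\<theta> > 0"
    and "Re (complex_of_real a - s / 2) > 0"
  shows
    "(distributed M (\<Pi>\<^sub>M n\<in>{..<N}. lborel) U (\<lambda>u. ennreal (selberg_density N a b u)) \<longrightarrow>
        has_bochner_integral M
          (\<lambda>\<omega>. vandermonde_pow N (s / 2) (U \<omega>) / vandermonde_pow N 0 (U \<omega>))
          (recip_Gamma_trunc (N - 1) (s / 2) * of_nat N powr (s / 2)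
             * (Gamma (complex_of_real (a + b - 1 + real N))
                / Gamma (complex_of_real a - s / 2 + complex_of_real (b - 1 + real N)))
             * (Gamma (complex_of_real a - s / 2) / Gamma (complex_of_real a))))
     \<and>
     (distributed M (\<Pi>\<^sub>M n\<in>{..<N}. lborel) U (\<lambda>u. ennreal (laguerre_density N a \<theta> u)) \<longrightarrow>
        has_bochner_integral M
          (\<lambda>\<omega>. vandermonde_pow N (s / 2) (U \<omega>) / vandermonde_pow N 0 (U \<omega>))
          (recip_Gamma_trunc (N - 1) (s / 2) * complex_of_real (real N / \<theta>) powr (s / 2)
             * (Gamma (complex_of_real a - s / 2) / Gamma (complex_of_real a))))"
proof -
  interpret prob_space M by fact
  define z where "z = s / 2"
  note a = \<open>a > 0\<close> and b = \<open>b > 0\<close> and \<theta> = \<open>\<theta> > 0\<close>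
  define A B where "A = complex_of_real a" and "B = complex_of_real b"
  have N: "N > 0" "N = Suc (N - 1)"
    using \<open>N \<ge> 2\<close> by simp_all
  \<comment> \<open>Exactly the points at which moments are required: \<open>z\<close> by the
    assumption on \<open>s\<close>, the points \<open>- i\<close> by \<open>a > 0\<close>.\<close>
  have Re_pos: "Re (A - y) > 0" if "y \<in> insert z ((\<lambda>i. - of_nat i) ` {..<N})" for y
    using that assms(6) a by (auto simp: A_def z_def add_pos_nonneg)
  have Re_nat: "Re (A - (- of_nat i)) > 0" for i
    using a by (simp add: A_def add_pos_nonneg)
  have prod_eq: "(\<Prod>k=1..N-1. 1 + z / of_nat k) = recip_Gamma_trunc (N - 1) z * of_nat N powr z"
    using recip_Gamma_trunc_times_powr[of "N - 1" z] N(2) by simp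
  show ?thesis
  proof (intro conjI impI)

    \<comment> \<open>The Selberg ensemble\<close>
    assume D: "distributed M (\<Pi>\<^sub>M n\<in>{..<N}. lborel) U (\<lambda>u. ennreal (selberg_density N a b u))"
    \<comment> \<open>The cutoff outside \<open>(0, 1)\<close> makes the product of the
      \<open>W (u i)\<close> carry the support condition of the density.\<close>
    define W where "W x = (if 0 < x \<and> x < 1 then x powr (a - 1) * (1 - x) powr (b - 1) else 0)" for x
    \<comment> \<open>The moments are \<open>Beta (A - y + j) B\<close>. Splitting
      \<open>(A - y)_j\<close> off the numerator and raising every denominator to the common
      \<open>Gamma (A - y + B + (N - 1))\<close> costs rising factorials of lengths \<open>j\<close>
      and \<open>N - 1 - j\<close>, so \<open>q j\<close> has degree at most
      \<open>N - 1\<close>.\<close>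
    define G where "G y = Gamma B * (Gamma (A - y) / Gamma (A - y + B + of_nat (N - 1)))" for y
    define q where "q j = pochhammer_poly A j * pochhammer_poly (A + B + of_nat j) (N - 1 - j)" for j
    have W_complex: "powr_pos w x * complex_of_real (W x) = powr_pos (w + A - 1) x * powr_pos (B - 1) (1 - x)"
      for w x
      by (auto simp: W_def A_def B_def powr_pos_def powr_of_real[symmetric] powr_add powr_diff)
    have "selberg_const N a b > 0"
      unfolding selberg_const_def using a b
      by (intro prod_pos) (auto intro!: divide_pos_pos mult_pos_pos Gamma_real_pos)
    then have K: "0 \<le> fact N / selberg_const N a b"
      by simp
    have density: "selberg_density N a b u = (if strict_mono_on {..<N} u
        then fact N / selberg_const N a b * (vandermonde_prod N u)\<^sup>2 * (\<Prod>i<N. W (u i)) else 0)" for u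
    proof (cases "\<forall>n<N. 0 < u n \<and> u n < 1")
      case True
      then have "(\<Prod>i<N. W (u i)) = (\<Prod>n<N. u n powr (a - 1) * (1 - u n) powr (b - 1))"
        by (intro prod.cong) (auto simp: W_def)
      with True show ?thesis
        by (simp add: selberg_density_def)
    next
      case False
      then have "(\<Prod>i<N. W (u i)) = 0"
        by (auto simp: W_def)
      with False show ?thesis
        by (auto simp: selberg_density_def)
    qed
    have "has_bochner_integral M (\<lambda>\<omega>. vandermonde_pow N z (U \<omega>) / vandermonde_pow N 0 (U \<omega>))
        (G z / G 0 * (\<Prod>k=1..N-1. 1 + z / of_nat k))"
    proof (rule vandermonde_ratio_expectation[where q = q and W = W])
      show "W \<in> borel_measurable borel"
        unfolding W_def by measurable
      show "0 \<le> W x" and "x \<le> 0 \<Longrightarrow> W x = 0" for x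
        by (auto simp: W_def)
      show "distributed M (\<Pi>\<^sub>M i\<in>{..<N}. lborel) U (\<lambda>u. ennreal (if strict_mono_on {..<N} u
          then fact N / selberg_const N a b * (vandermonde_prod N u)\<^sup>2 * (\<Prod>i<N. W (u i)) else 0))"
        using D by (simp only: density)
      show "degree (q j) \<le> N - 1" if "j < N" for j
        using degree_mult_le[of "pochhammer_poly A j" "pochhammer_poly (A + B + of_nat j) (N - 1 - j)"]
          degree_pochhammer_poly[of A j] degree_pochhammer_poly[of "A + B + of_nat j" "N - 1 - j"] that
        unfolding q_def by linarith
      show "G (- of_nat i) \<noteq> 0" for i
      proof -
        have "Re (A - (- of_nat i) + B + of_nat (N - 1)) > 0" "Re B > 0"
          using a b by (simp_all add: A_def B_def add_pos_nonneg)
        then show ?thesis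
          unfolding G_def using Re_nat by (simp add: Gamma_nonzero del: minus_complex.sel plus_complex.sel)
      qed
      show "has_bochner_integral lborel (\<lambda>x. powr_pos (of_nat j - y) x * complex_of_real (W x))
          (G y * poly (q j) y)"
        if y: "y \<in> insert z ((\<lambda>i. - of_nat i) ` {..<N})" and j: "j < N" for y j
      proof -
        have pos: "Re (A - y + of_nat j) > 0" "Re B > 0" "Re (A - y + B + of_nat j) > 0"
          using Re_pos[OF y] b by (simp_all add: B_def)
        have "has_bochner_integral lborel (\<lambda>x. powr_pos (of_nat j - y) x * complex_of_real (W x))
            (Beta (A - y + of_nat j) B)"
          using has_bochner_integral_Beta[OF pos(1,2)] unfolding W_complex by (simp add: algebra_simps)
        moreover have "Gamma (A - y + of_nat j) = pochhammer (A - y) j * Gamma (A - y)"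
          by (rule Gamma_plus_of_nat[OF Re_pos[OF y]])
        moreover have "Gamma (A - y + B + of_nat (N - 1)) =
            pochhammer (A - y + B + of_nat j) (N - 1 - j) * Gamma (A - y + B + of_nat j)"
        proof -
          have "(of_nat (N - 1) :: complex) = of_nat j + of_nat (N - 1 - j)"
            using j by (simp flip: of_nat_add)
          then show ?thesis
            using Gamma_plus_of_nat[OF pos(3), of "N - 1 - j"] by (simp add: add.assoc)
        qed
        moreover have "Gamma (A - y + B + of_nat (N - 1)) \<noteq> 0"
          by (rule Gamma_nonzero) (use Re_pos[OF y] b in \<open>simp add: B_def\<close>)
        ultimately show ?thesis
          by (simp add: Beta_def G_def q_def poly_pochhammer_poly divide_simps) (simp add: algebra_simps)
      qed
    qed (use N K in auto)
    moreover have "G z / G 0 = Gamma (complex_of_real (a + b - 1 + real N))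
        / Gamma (complex_of_real a - s / 2 + complex_of_real (b - 1 + real N))
        * (Gamma (complex_of_real a - s / 2) / Gamma (complex_of_real a))"
    proof -
      have eqs: "A + B + of_nat (N - 1) = complex_of_real (a + b - 1 + real N)"
        "A - z + B + of_nat (N - 1) = complex_of_real a - s / 2 + complex_of_real (b - 1 + real N)"
        using N by (simp_all add: A_def B_def z_def of_nat_diff)
      have "Gamma B \<noteq> 0"
        by (rule Gamma_nonzero) (use b in \<open>simp add: B_def\<close>)
      then have "G z / G 0 = Gamma (A + B + of_nat (N - 1)) / Gamma (A - z + B + of_nat (N - 1))
          * (Gamma (A - z) / Gamma A)"
        by (simp add: G_def)
      then show ?thesis
        unfolding eqs unfolding A_def z_def .
    qed
    ultimately show "has_bochner_integral M
          (\<lambda>\<omega>. vandermonde_pow N (s / 2) (U \<omega>) / vandermonde_pow N 0 (U \<omega>))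
          (recip_Gamma_trunc (N - 1) (s / 2) * of_nat N powr (s / 2)
             * (Gamma (complex_of_real (a + b - 1 + real N))
                / Gamma (complex_of_real a - s / 2 + complex_of_real (b - 1 + real N)))
             * (Gamma (complex_of_real a - s / 2) / Gamma (complex_of_real a)))"
      unfolding prod_eq by (simp only: z_def[symmetric] mult_ac)
  next

    \<comment> \<open>The Laguerre ensemble\<close>
    assume D: "distributed M (\<Pi>\<^sub>M n\<in>{..<N}. lborel) U (\<lambda>u. ennreal (laguerre_density N a \<theta> u))"
    define W where "W x = (if 0 < x then x powr (a - 1) * exp (- x / \<theta>) else 0)" for x
    \<comment> \<open>The moment \<open>\<theta> powr (A - y + j) * Gamma (A - y + j)\<close>
      exceeds \<open>G y\<close> by the scalar \<open>\<theta> ^ j\<close> and the rising factorial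
      of \<open>A - y\<close> of length \<open>j\<close>; both go into \<open>q j\<close>.\<close>
    define G where "G y = complex_of_real \<theta> powr (A - y) * Gamma (A - y)" for y
    define q where "q j = Polynomial.smult (complex_of_real \<theta> ^ j) (pochhammer_poly A j)" for j
    have W_complex: "powr_pos w x * complex_of_real (W x) =
        powr_pos (w + A - 1) x * complex_of_real (exp (- x / \<theta>))" for w x
      by (auto simp: W_def A_def powr_pos_def powr_of_real[symmetric] powr_add powr_diff)
    have "laguerre_const N a \<theta> > 0"
      unfolding laguerre_const_def using a \<theta>
      by (intro prod_pos mult_pos_pos) (auto intro!: Gamma_real_pos)
    then have K: "0 \<le> fact N / laguerre_const N a \<theta>"
      by simp
    have density: "laguerre_density N a \<theta> u = (if strict_mono_on {..<N} u
        then fact N / laguerre_const N a \<theta> * (vandermonde_prod N u)\<^sup>2 * (\<Prod>i<N. W (u i)) else 0)" for u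
    proof (cases "\<forall>n<N. 0 < u n")
      case True
      then have "(\<Prod>i<N. W (u i)) = (\<Prod>n<N. u n powr (a - 1) * exp (- u n / \<theta>))"
        by (intro prod.cong) (auto simp: W_def)
      with True show ?thesis
        by (simp add: laguerre_density_def)
    next
      case False
      then have "(\<Prod>i<N. W (u i)) = 0"
        by (auto simp: W_def)
      with False show ?thesis
        by (auto simp: laguerre_density_def)
    qed
    have "has_bochner_integral M (\<lambda>\<omega>. vandermonde_pow N z (U \<omega>) / vandermonde_pow N 0 (U \<omega>))
        (G z / G 0 * (\<Prod>k=1..N-1. 1 + z / of_nat k))"
    proof (rule vandermonde_ratio_expectation[where q = q and W = W])
      show "W \<in> borel_measurable borel"
        unfolding W_def by measurable
      show "0 \<le> W x" and "x \<le> 0 \<Longrightarrow> W x = 0" for x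
        by (auto simp: W_def)
      show "distributed M (\<Pi>\<^sub>M i\<in>{..<N}. lborel) U (\<lambda>u. ennreal (if strict_mono_on {..<N} u
          then fact N / laguerre_const N a \<theta> * (vandermonde_prod N u)\<^sup>2 * (\<Prod>i<N. W (u i)) else 0))"
        using D by (simp only: density)
      show "degree (q j) \<le> N - 1" if "j < N" for j
        using degree_smult_le[of "complex_of_real \<theta> ^ j" "pochhammer_poly A j"]
          degree_pochhammer_poly[of A j] that
        unfolding q_def by linarith
      show "G (- of_nat i) \<noteq> 0" for i
        unfolding G_def using Gamma_nonzero[OF Re_nat] \<theta> by simp
      show "has_bochner_integral lborel (\<lambda>x. powr_pos (of_nat j - y) x * complex_of_real (W x))
          (G y * poly (q j) y)"
        if y: "y \<in> insert z ((\<lambda>i. - of_nat i) ` {..<N})" and j: "j < N" for y j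
      proof -
        have pos: "Re (A - y + of_nat j) > 0"
          using Re_pos[OF y] by simp
        have "has_bochner_integral lborel (\<lambda>x. powr_pos (of_nat j - y) x * complex_of_real (W x))
            (complex_of_real \<theta> powr (A - y + of_nat j) * Gamma (A - y + of_nat j))"
          using has_bochner_integral_Gamma_scaled[OF pos \<theta>] unfolding W_complex
          by (simp add: algebra_simps)
        moreover have "Gamma (A - y + of_nat j) = pochhammer (A - y) j * Gamma (A - y)"
          by (rule Gamma_plus_of_nat[OF Re_pos[OF y]])
        moreover have "complex_of_real \<theta> powr (A - y + of_nat j) =
            complex_of_real \<theta> powr (A - y) * complex_of_real \<theta> ^ j"
          using \<theta> by (subst powr_add) (simp add: powr_nat')
        ultimately show ?thesis
          by (simp add: G_def q_def poly_pochhammer_poly mult_ac)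
      qed
    qed (use N K in auto)
    moreover have "G z / G 0 * (\<Prod>k=1..N-1. 1 + z / of_nat k) = recip_Gamma_trunc (N - 1) z *
        complex_of_real (real N / \<theta>) powr z * (Gamma (A - z) / Gamma A)"
    proof -
      \<comment> \<open>The telescoped product contributes \<open>N powr z\<close> and
        \<open>G z / G 0\<close> contributes \<open>\<theta> powr (- z)\<close>; they merge because
        the bases are nonnegative reals.\<close>
      have "complex_of_real (real N / \<theta>) powr z * complex_of_real \<theta> powr z =
          (complex_of_real (real N / \<theta>) * complex_of_real \<theta>) powr z"
        using \<theta> by (intro powr_times_real[symmetric]) auto
      also have "complex_of_real (real N / \<theta>) * complex_of_real \<theta> = of_nat N"
        using \<theta> by simp
      finally have "of_nat N powr z / complex_of_real \<theta> powr z = complex_of_real (real N / \<theta>) powr z"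
        using \<theta> by (simp add: field_simps)
      moreover have "of_nat N powr z * (G z / G 0) =
          of_nat N powr z / complex_of_real \<theta> powr z * (Gamma (A - z) / Gamma A)"
        using \<theta> by (simp add: G_def powr_diff)
      moreover have "G z / G 0 * (\<Prod>k=1..N-1. 1 + z / of_nat k) =
          recip_Gamma_trunc (N - 1) z * (of_nat N powr z * (G z / G 0))"
        unfolding prod_eq by (simp only: mult_ac)
      ultimately show ?thesis
        by (simp only: mult.assoc)
    qed
    ultimately show "has_bochner_integral M
          (\<lambda>\<omega>. vandermonde_pow N (s / 2) (U \<omega>) / vandermonde_pow N 0 (U \<omega>))
          (recip_Gamma_trunc (N - 1) (s / 2) * complex_of_real (real N / \<theta>) powr (s / 2)
             * (Gamma (complex_of_real a - s / 2) / Gamma (complex_of_real a)))"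
      by (simp only: z_def A_def)
  qed
qed

end
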